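(* Let $p>3$ be a prime for which Strong Approximation holds, i.e. the orbit of $(1,1,1)$ in $(\mathbb{Z}/p\mathbb{Z})^3$ under the Vieta group $\Gamma$ equals $\mathcal{X}^*(p)$, and let $h(p)$ be the expansion constant of the Markoff graph $\mathcal{G}_p$. For $\mathbf{x}\in\mathcal{X}^*(p)$, let $\tilde{\mathbf{x}}$ be a lift of $\mathbf{x}$ of minimal size. Then \[\operatorname{size}(\tilde{\mathbf{x}})<(3\epsilon)^{\alpha},\qquad \epsilon=\frac{3+\sqrt5}{2},\qquad \alpha=\left(\frac{p^3+3}{2}\right)^{20/\log\left(1+\frac{h(p)}{3}\right)}.\]
   Context: The Markoff surface is $X_1^2+X_2^2+X_3^2=3X_1X_2X_3$. A Markoff triple is an integer solution; $\mathcal{X}^*(p)$ is the set of solutions in $(\mathbb{Z}/p\mathbb{Z})^3$ other than $(0,0,0)$. The size of a Markoff triple is $\max\{x_1,x_2,x_3\}$; a lift of $\mathbf{x}\in\mathcal{X}^*(p)$ is a Markoff triple congruent to $\mathbf{x}$ mod $p$. The Vieta group $\Gamma$ is the group of polynomial maps of affine 3-space generated by the coordinate permutations $\sigma_{ij}$ and the Vieta involutions $R_1(x_1,x_2,x_3)=(3x_2x_3-x_1,x_2,x_3)$, $R_2(x_1,x_2,x_3)=(x_1,3x_1x_3-x_2,x_3)$, $R_3(x_1,x_2,x_3)=(x_1,x_2,3x_1x_2-x_3)$. The rotations are $\mathrm{rot}_1(x_1,x_2,x_3)=(x_1,x_3,3x_1x_3-x_2)$, $\mathrm{rot}_2(x_1,x_2,x_3)=(x_3,x_2,3x_2x_3-x_1)$,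 $\mathrm{rot}_3(x_1,x_2,x_3)=(x_2,3x_2x_3-x_1,x_3)$. The Markoff mod $p$ graph $\mathcal{G}_p$ has vertex set $\mathcal{X}^*(p)$ and edges $(\mathbf{x},\mathrm{rot}_i\mathbf{x})$ for $\mathbf{x}\in\mathcal{X}^*(p)$, $i\in\{1,2,3\}$. The expansion constant of a finite graph $G=(V,E)$ is $h(G)=\min\{|E(W)|/|W|: W\subset V,\ 1\le|W|\le|V|/2\}$, where $E(W)$ is the set of edges with exactly one endpoint in $W$. *)

theory Defs
  imports Complex_Main "HOL-Number_Theory.Cong" "HOL-Algebra.Bij" "HOL-Algebra.Generated_Groups"
begin

type_synonym triple = "int \<times> int \<times> int"

fun markoff_triple :: "triple \<Rightarrow> bool" where
  "markoff_triple (x1, x2, x3) \<longleftrightarrow> x1\<^sup>2 + x2\<^sup>2 + x3\<^sup>2 = 3 * x1 * x2 * x3"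

fun markoff_size :: "triple \<Rightarrow> int" where
  "markoff_size (x1, x2, x3) = Max {x1, x2, x3}"

text \<open>Elements of \<open>(\<int>/p\<int>)\<^sup>3\<close> are represented by their canonical representatives, i.e. the
  integer triples with all coordinates in \<open>{0..<p}\<close>. A polynomial map \<open>f\<close> with integer
  coefficients acts on them by \<open>x \<mapsto> reduce p (f x)\<close>.\<close>

fun reduce :: "nat \<Rightarrow> triple \<Rightarrow> triple" where
  "reduce p (x1, x2, x3) = (x1 mod int p, x2 mod int p, x3 mod int p)"

definition markoff_mod :: "nat \<Rightarrow> triple set" where
  "markoff_mod p =
    {(x1, x2, x3). x1 \<in> {0..<int p} \<and> x2 \<in> {0..<int p} \<and> x3 \<in> {0..<int p} \<and>
       [x1\<^sup>2 + x2\<^sup>2 + x3\<^sup>2 = 3 * x1 * x2 * x3] (mod int p)} - {(0, 0, 0)}"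

fun is_lift :: "nat \<Rightarrow> triple \<Rightarrow> triple \<Rightarrow> bool" where
  "is_lift p (x1, x2, x3) (y1, y2, y3) \<longleftrightarrow>
     markoff_triple (y1, y2, y3) \<and>
     [y1 = x1] (mod int p) \<and> [y2 = x2] (mod int p) \<and> [y3 = x3] (mod int p)"

fun perm12 :: "triple \<Rightarrow> triple" where "perm12 (x1, x2, x3) = (x2, x1, x3)"
fun perm13 :: "triple \<Rightarrow> triple" where "perm13 (x1, x2, x3) = (x3, x2, x1)"
fun perm23 :: "triple \<Rightarrow> triple" where "perm23 (x1, x2, x3) = (x1, x3, x2)"

fun vieta1 :: "triple \<Rightarrow> triple" where "vieta1 (x1, x2, x3) = (3 * x2 * x3 - x1, x2, x3)"
fun vieta2 :: "triple \<Rightarrow> triple" where "vieta2 (x1, x2, x3) = (x1, 3 * x1 * x3 - x2, x3)"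
fun vieta3 :: "triple \<Rightarrow> triple" where "vieta3 (x1, x2, x3) = (x1, x2, 3 * x1 * x2 - x3)"

text \<open>Since \<open>\<int>\<close> is infinite, a polynomial map with integer coefficients is determined by the
  function it induces on \<open>\<int>\<^sup>3\<close>, so the group of polynomial maps is realised as a group of
  bijections of \<open>\<int>\<^sup>3\<close>.\<close>

definition vieta_generators :: "(triple \<Rightarrow> triple) set" where
  "vieta_generators = {perm12, perm13, perm23, vieta1, vieta2, vieta3}"

definition vieta_group :: "(triple \<Rightarrow> triple) set" where
  "vieta_group = generate (BijGroup UNIV) vieta_generators"

lemma vieta_generators_carrier: "vieta_generators \<subseteq> carrier (BijGroup UNIV)"
proof -
  have "f \<circ> f = id" if "f \<in> vieta_generators" for f
    using that by (auto simp: vieta_generators_def fun_eq_iff)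
  then show ?thesis
    by (auto simp: BijGroup_def Bij_def extensional_def intro: o_bij)
qed

definition vieta_orbit :: "nat \<Rightarrow> triple \<Rightarrow> triple set" where
  "vieta_orbit p x = {reduce p (g x) | g. g \<in> vieta_group}"

definition strong_approximation :: "nat \<Rightarrow> bool" where
  "strong_approximation p \<longleftrightarrow> vieta_orbit p (1, 1, 1) = markoff_mod p"

fun rot1 :: "triple \<Rightarrow> triple" where "rot1 (x1, x2, x3) = (x1, x3, 3 * x1 * x3 - x2)"
fun rot2 :: "triple \<Rightarrow> triple" where "rot2 (x1, x2, x3) = (x3, x2, 3 * x2 * x3 - x1)"
fun rot3 :: "triple \<Rightarrow> triple" where "rot3 (x1, x2, x3) = (x2, 3 * x2 * x3 - x1, x3)"

definition markoff_edges :: "nat \<Rightarrow> (triple \<times> triple) set" where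
  "markoff_edges p = {(x, reduce p (r x)) | x r. x \<in> markoff_mod p \<and> r \<in> {rot1, rot2, rot3}}"

definition edge_boundary :: "('a \<times> 'a) set \<Rightarrow> 'a set \<Rightarrow> ('a \<times> 'a) set" where
  "edge_boundary E W = {(x, y) \<in> E. (x \<in> W) \<noteq> (y \<in> W)}"

text \<open>Intended for finite \<open>V\<close> with at least two elements, so that \<open>Min\<close> is taken over a finite
  nonempty set.\<close>

definition expansion_constant :: "'a set \<Rightarrow> ('a \<times> 'a) set \<Rightarrow> real" where
  "expansion_constant V E =
    Min {real (card (edge_boundary E W)) / real (card W) | W.
           W \<subseteq> V \<and> 1 \<le> card W \<and> real (card W) \<le> real (card V) / 2}"

definition markoff_expansion :: "nat \<Rightarrow> real" where
  "markoff_expansion p = expansion_constant (markoff_mod p) (markoff_edges p)"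

end

theory Submission
  imports Defs
begin

text \<open>
  The coordinate permutations fix \<open>(1,1,1)\<close> and conjugate the rotations to rotations or their
  inverses, so the \<open>\<Gamma>\<close>-orbit of \<open>(1,1,1)\<close> is already its orbit under rotations and their inverses.
  Hence strong approximation makes the Markoff graph connected and \<open>h = h(p) > 0\<close>. Every vertex
  lies on at most six edges, so a ball with at most half of the vertices grows by a factor of at
  least \<open>1 + h/6\<close> when its radius is increased by one. Two balls with more than half of the vertices
  meet, which gives a walk from \<open>(1,1,1)\<close> to any vertex of length \<open>k = 2 \<lceil>log A / log (1 + h/6)\<rceil>\<close>,
  where \<open>A = (p\<^sup>3 + 3)/2\<close> exceeds half the number of vertices. Performing the same steps over the
  integers produces a lift, and one step turns a bound \<open>M\<close> on the absolute values of the coordinates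
  into \<open>4M\<^sup>2\<close>, so that \<open>4M \<le> 4 ^ 2 ^ k\<close> at the end of the walk. Finally
  \<open>(1 + h/6)\<^sup>2 \<ge> 1 + h/3\<close> bounds \<open>2 ^ k\<close> by the power of \<open>A\<close> with exponent \<open>6 / log (1 + h/3)\<close>.
\<close>

lemma int_le_square: "M \<le> M\<^sup>2" for M :: int
proof (cases "1 \<le> M")
  case True
  then show ?thesis by (simp add: self_le_power)
next
  case False
  then show ?thesis using zero_le_power2[of M] by linarith
qed

lemma power_ge_and_two_power_le_powr:
  fixes A b c :: real
  assumes "1 < b" "1 < c" "c \<le> b\<^sup>2" "c \<le> A"
  obtains n :: nat where "A \<le> b ^ n" "2 ^ (2 * n) \<le> A powr (6 / ln c)"
proof
  define n where "n = nat \<lceil>log b A\<rceil>"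
  have "1 < A" using assms by linarith
  then have "0 < log b A" using assms(1) by simp
  then have n: "log b A \<le> n" "n \<le> log b A + 1" unfolding n_def by linarith+
  show "A \<le> b ^ n"
    using n(1) assms(1) \<open>1 < A\<close> by (simp add: log_le_iff powr_realpow)
  have "log b A \<le> 2 * log c A"
  proof -
    have "ln c \<le> 2 * ln b"
      using assms ln_mono[of c "b\<^sup>2"] by (simp add: ln_realpow)
    then have "ln A * ln c \<le> ln A * (2 * ln b)"
      using \<open>1 < A\<close> by (intro mult_left_mono) auto
    then show ?thesis using assms(1,2) by (simp add: log_def field_simps)
  qed
  moreover have "1 \<le> log c A"
    using assms(2,4) by (simp add: le_log_iff)
  ultimately have n_le: "n \<le> 3 * log c A" using n(2) by linarith
  have "(2::real) ^ (2 * n) \<le> exp 1 ^ (2 * n)"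
    using exp_ge_add_one_self[of 1] by (intro power_mono) auto
  also have "\<dots> = exp (2 * n)" by (simp flip: exp_of_nat_mult)
  also have "\<dots> \<le> exp (6 * log c A)" using n_le by simp
  also have "\<dots> = A powr (6 / ln c)"
    using \<open>1 < A\<close> by (simp add: powr_def log_def)
  finally show "2 ^ (2 * n) \<le> A powr (6 / ln c)" .
qed

lemma ex_is_arg_min_int:
  fixes f :: "'a \<Rightarrow> int"
  assumes "P a" "\<And>x. P x \<Longrightarrow> m \<le> f x"
  shows "\<exists>x. is_arg_min f P x"
proof -
  obtain x where "is_arg_min (\<lambda>x. nat (f x - m)) P x"
    using is_arg_min_arg_min_nat[of P a] assms(1) by blast
  then have "is_arg_min f P x"
    using assms(2) by (force simp: is_arg_min_linorder nat_le_eq_zle)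
  then show ?thesis ..
qed

lemma generate_BijGroup_image_eq:
  assumes "H \<subseteq> carrier (BijGroup UNIV)" "\<And>h. h \<in> H \<Longrightarrow> h ` S = S"
    and "g \<in> generate (BijGroup UNIV) H"
  shows "g ` S = S"
  using assms(3)
proof induction
  case one
  show ?case by (simp add: BijGroup_def)
next
  case (incl h)
  then show ?case by (rule assms(2))
next
  case (inv h)
  then have "h \<in> Bij UNIV" using assms(1) by (auto simp: BijGroup_def)
  then have "inj h" by (simp add: Bij_def bij_betw_def)
  then have "inv_into UNIV h ` S = S"
    using inv_into_image_cancel[of h UNIV S] assms(2)[OF inv] by simp
  then show ?case by (simp add: inv_BijGroup[OF \<open>h \<in> Bij UNIV\<close>])
next
  case (eng g h)
  interpret group "BijGroup UNIV" by (rule group_BijGroup)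
  have "g \<in> Bij UNIV" "h \<in> Bij UNIV"
    using eng.hyps[THEN generate_in_carrier[OF assms(1)]] by (simp_all add: BijGroup_def)
  moreover have "(g \<circ> h) ` S = S"
    using eng.IH by (metis image_comp)
  ultimately show ?case by (simp add: BijGroup_def compose_def comp_def)
qed

section \<open>Expansion and distance in finite graphs\<close>

definition small_subsets :: "'a set \<Rightarrow> 'a set set" where
  "small_subsets V = {W. W \<subseteq> V \<and> 1 \<le> card W \<and> real (card W) \<le> real (card V) / 2}"

definition boundary_ratio :: "('a \<times> 'a) set \<Rightarrow> 'a set \<Rightarrow> real" where
  "boundary_ratio E W = real (card (edge_boundary E W)) / real (card W)"

lemma expansion_constant_eq_Min:
  "expansion_constant V E = (MIN W\<in>small_subsets V. boundary_ratio E W)"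
  unfolding expansion_constant_def small_subsets_def boundary_ratio_def
  by (rule arg_cong[where f = Min]) blast

definition incident_edges :: "('a \<times> 'a) set \<Rightarrow> 'a \<Rightarrow> ('a \<times> 'a) set" where
  "incident_edges E v = {e \<in> E. fst e = v \<or> snd e = v}"

definition closed_neighbourhood :: "('a \<times> 'a) set \<Rightarrow> 'a set \<Rightarrow> 'a set" where
  "closed_neighbourhood E B = (E \<union> E\<inverse>)\<^sup>= `` B"

definition graph_ball :: "('a \<times> 'a) set \<Rightarrow> 'a \<Rightarrow> nat \<Rightarrow> 'a set" where
  "graph_ball E x n = ((E \<union> E\<inverse>)\<^sup>= ^^ n) `` {x}"

lemma graph_ball_0 [simp]: "graph_ball E x 0 = {x}"
  by (simp add: graph_ball_def)

lemma graph_ball_Suc: "graph_ball E x (Suc n) = closed_neighbourhood E (graph_ball E x n)"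
  unfolding graph_ball_def closed_neighbourhood_def relpow.simps relcomp_Image ..

lemma subset_closed_neighbourhood: "B \<subseteq> closed_neighbourhood E B"
  by (auto simp: closed_neighbourhood_def)

lemma graph_ball_mono:
  assumes "m \<le> n"
  shows "graph_ball E x m \<subseteq> graph_ball E x n"
proof (rule lift_Suc_mono_le[OF _ assms])
  show "graph_ball E x k \<subseteq> graph_ball E x (Suc k)" for k
    unfolding graph_ball_Suc by (rule subset_closed_neighbourhood)
qed

lemma center_in_graph_ball: "x \<in> graph_ball E x n"
  using graph_ball_mono[of 0 n] by auto

lemma graph_ball_trans:
  assumes "y \<in> graph_ball E x m" "z \<in> graph_ball E y n"
  shows "z \<in> graph_ball E x (m + n)"
  using assms by (auto simp: graph_ball_def relpow_add)

lemma graph_ball_sym: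
  assumes "y \<in> graph_ball E x n"
  shows "x \<in> graph_ball E y n"
  using assms
proof (induction n arbitrary: y)
  case (Suc n)
  then obtain z where z: "z \<in> graph_ball E x n" "z \<in> graph_ball E y (Suc 0)"
    unfolding graph_ball_Suc by (auto simp: closed_neighbourhood_def)
  then show ?case
    using graph_ball_trans[OF z(2) Suc.IH[OF z(1)]] by simp
qed simp

lemma edge_boundary_nonempty_if_reachable:
  assumes "W \<subseteq> V" "W \<noteq> {}" "W \<noteq> V" "V \<subseteq> (E \<union> E\<inverse>)\<^sup>* `` {v}"
  shows "edge_boundary E W \<noteq> {}"
proof
  assume no_boundary: "edge_boundary E W = {}"
  have "v \<in> W \<longleftrightarrow> w \<in> W" if "(v, w) \<in> (E \<union> E\<inverse>)\<^sup>*" for w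
    using that
  proof induction
    case (step y z)
    then show ?case using no_boundary unfolding edge_boundary_def by blast
  qed simp
  then show False using assms by blast
qed

locale finite_digraph =
  fixes V :: "'a set" and E :: "('a \<times> 'a) set"
  assumes finite_vertices: "finite V"
    and edges_subset: "E \<subseteq> V \<times> V"
begin

abbreviation h :: real where "h \<equiv> expansion_constant V E"

lemma finite_edges: "finite E"
  using edges_subset finite_vertices by (meson finite_SigmaI finite_subset)

lemma finite_small_subsets: "finite (small_subsets V)"
  by (rule finite_subset[of _ "Pow V"]) (auto simp: small_subsets_def finite_vertices)

lemma singleton_in_small_subsets: "v \<in> V \<Longrightarrow> 2 \<le> card V \<Longrightarrow> {v} \<in> small_subsets V"
  by (simp add: small_subsets_def)

lemma expansion_constant_le: "W \<in> small_subsets V \<Longrightarrow> h \<le> boundary_ratio E W"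
  unfolding expansion_constant_eq_Min by (intro Min_le) (auto simp: finite_small_subsets)

lemma expansion_constant_pos:
  assumes "2 \<le> card V" "v \<in> V" "V \<subseteq> (E \<union> E\<inverse>)\<^sup>* `` {v}"
  shows "0 < h"
proof -
  have "0 < boundary_ratio E W" if "W \<in> small_subsets V" for W
  proof -
    have W: "W \<subseteq> V" "0 < card W" "W \<noteq> {}" "W \<noteq> V"
      using that assms(1) by (auto simp: small_subsets_def)
    then have "edge_boundary E W \<noteq> {}"
      using assms(3) by (intro edge_boundary_nonempty_if_reachable)
    moreover have "finite (edge_boundary E W)"
      by (rule finite_subset[OF _ finite_edges]) (auto simp: edge_boundary_def)
    ultimately show ?thesis
      using W(2) by (simp add: boundary_ratio_def card_gt_0_iff)
  qed
  then show ?thesis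
    unfolding expansion_constant_eq_Min
    using singleton_in_small_subsets[OF assms(2,1)]
    by (subst Min_gr_iff) (auto simp: finite_small_subsets)
qed

lemma closed_neighbourhood_subset: "B \<subseteq> V \<Longrightarrow> closed_neighbourhood E B \<subseteq> V"
  using edges_subset by (auto simp: closed_neighbourhood_def)

lemma graph_ball_subset: "x \<in> V \<Longrightarrow> graph_ball E x n \<subseteq> V"
  by (induction n) (simp_all add: graph_ball_Suc closed_neighbourhood_subset)

lemma finite_graph_ball: "x \<in> V \<Longrightarrow> finite (graph_ball E x n)"
  using graph_ball_subset finite_vertices finite_subset by blast

end

locale bounded_degree_digraph = finite_digraph +
  fixes d :: nat
  assumes degree_pos: "0 < d"
    and card_incident_edges_le: "v \<in> V \<Longrightarrow> card (incident_edges E v) \<le> d"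
begin

lemma card_edge_boundary_le:
  assumes "B \<subseteq> V"
  shows "card (edge_boundary E B) \<le> card (closed_neighbourhood E B - B) * d"
proof -
  let ?N = "closed_neighbourhood E B - B"
  have "finite ?N"
    using closed_neighbourhood_subset[OF assms] finite_vertices finite_subset by blast
  have "edge_boundary E B \<subseteq> (\<Union>v\<in>?N. incident_edges E v)"
    by (fastforce simp: edge_boundary_def closed_neighbourhood_def incident_edges_def)
  then have "card (edge_boundary E B) \<le> card (\<Union>v\<in>?N. incident_edges E v)"
    using \<open>finite ?N\<close> finite_edges by (intro card_mono) (auto simp: incident_edges_def)
  also have "\<dots> \<le> (\<Sum>v\<in>?N. card (incident_edges E v))"
    using \<open>finite ?N\<close> by (rule card_UN_le)
  also have "\<dots> \<le> card ?N * d"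
    using card_incident_edges_le closed_neighbourhood_subset[OF assms]
      sum_bounded_above[of ?N "\<lambda>v. card (incident_edges E v)" d] by auto
  finally show ?thesis .
qed

lemma expansion_constant_le_degree:
  assumes "2 \<le> card V" "v \<in> V"
  shows "h \<le> d"
proof -
  have "edge_boundary E {v} \<subseteq> incident_edges E v"
    by (auto simp: edge_boundary_def incident_edges_def)
  then have "card (edge_boundary E {v}) \<le> card (incident_edges E v)"
    by (intro card_mono) (simp_all add: incident_edges_def finite_edges)
  also have "\<dots> \<le> d"
    using assms(2) by (rule card_incident_edges_le)
  finally show ?thesis
    using expansion_constant_le[OF singleton_in_small_subsets[OF assms(2,1)]]
    by (simp add: boundary_ratio_def)
qed

lemma card_closed_neighbourhood_ge:
  assumes "B \<in> small_subsets V"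
  shows "(1 + h / d) * card B \<le> card (closed_neighbourhood E B)"
proof -
  let ?C = "closed_neighbourhood E B"
  have B: "B \<subseteq> V" "0 < card B"
    using assms by (auto simp: small_subsets_def)
  have "h * card B \<le> card (edge_boundary E B)"
    using expansion_constant_le[OF assms] B(2) by (simp add: boundary_ratio_def field_simps)
  also have "\<dots> \<le> card (?C - B) * d"
    using card_edge_boundary_le[OF B(1)] by (metis of_nat_mult of_nat_mono)
  finally have "h / d * card B \<le> card (?C - B)"
    using degree_pos by (simp add: field_simps)
  moreover have "card ?C = card (?C - B) + card B"
    using B closed_neighbourhood_subset[OF B(1)] finite_vertices subset_closed_neighbourhood[of B E]
    by (metis card_Diff_subset card_mono finite_subset le_add_diff_inverse2)
  ultimately show ?thesis by (simp add: algebra_simps)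
qed

lemma card_graph_ball_ge:
  assumes "x \<in> V" "0 \<le> h" "card (graph_ball E x n) \<le> card V / 2"
  shows "(1 + h / d) ^ n \<le> card (graph_ball E x n)"
  using assms(3)
proof (induction n)
  case (Suc n)
  let ?B = "graph_ball E x n"
  have "card ?B \<le> card (graph_ball E x (Suc n))"
    using assms(1) by (intro card_mono finite_graph_ball graph_ball_mono) auto
  with Suc.prems have small: "card ?B \<le> card V / 2" by linarith
  moreover have "0 < card ?B"
    using center_in_graph_ball[of x E n] finite_graph_ball[OF assms(1)]
    unfolding card_gt_0_iff by blast
  ultimately have "?B \<in> small_subsets V"
    using graph_ball_subset[OF assms(1)] by (simp add: small_subsets_def)
  have "(1 + h / d) ^ Suc n \<le> (1 + h / d) * card ?B"
    using Suc.IH[OF small] assms(2) by (simp add: mult_left_mono)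
  also have "\<dots> \<le> card (graph_ball E x (Suc n))"
    unfolding graph_ball_Suc using \<open>?B \<in> small_subsets V\<close> by (rule card_closed_neighbourhood_ge)
  finally show ?case .
qed simp

lemma expander_diameter:
  assumes "x \<in> V" "y \<in> V" "0 \<le> h" "card V / 2 < (1 + h / d) ^ n"
  shows "y \<in> graph_ball E x (2 * n)"
proof -
  have large: "card V / 2 < card (graph_ball E v n)" if "v \<in> V" for v
    using card_graph_ball_ge[OF that assms(3)] assms(4) by (meson less_le_trans not_le)
  have "graph_ball E x n \<inter> graph_ball E y n \<noteq> {}"
  proof
    assume "graph_ball E x n \<inter> graph_ball E y n = {}"
    then have "card (graph_ball E x n) + card (graph_ball E y n)
        = card (graph_ball E x n \<union> graph_ball E y n)"
      using assms(1,2) by (simp add: card_Un_disjoint finite_graph_ball)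
    also have "\<dots> \<le> card V"
      using assms(1,2) by (intro card_mono finite_vertices Un_least graph_ball_subset)
    finally show False
      using large[OF assms(1)] large[OF assms(2)] by linarith
  qed
  then obtain z where "z \<in> graph_ball E x n" "z \<in> graph_ball E y n" by blast
  then show ?thesis
    using graph_ball_trans[OF _ graph_ball_sym] by (metis mult_2)
qed

end

section \<open>Rotations of Markoff triples\<close>

fun rot1_inv :: "triple \<Rightarrow> triple" where "rot1_inv (x1, x2, x3) = (x1, 3 * x1 * x2 - x3, x2)"
fun rot2_inv :: "triple \<Rightarrow> triple" where "rot2_inv (x1, x2, x3) = (3 * x1 * x2 - x3, x2, x1)"
fun rot3_inv :: "triple \<Rightarrow> triple" where "rot3_inv (x1, x2, x3) = (3 * x1 * x3 - x2, x1, x3)"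

definition rotations :: "(triple \<Rightarrow> triple) set" where
  "rotations = {rot1, rot2, rot3}"

definition inverse_rotations :: "(triple \<Rightarrow> triple) set" where
  "inverse_rotations = {rot1_inv, rot2_inv, rot3_inv}"

definition rotation_moves :: "(triple \<Rightarrow> triple) set" where
  "rotation_moves = rotations \<union> inverse_rotations"

lemmas rotation_moves_defs = rotation_moves_def rotations_def inverse_rotations_def

lemma rotation_in_moves: "r \<in> rotations \<Longrightarrow> r \<in> rotation_moves"
  and inverse_rotation_in_moves: "s \<in> inverse_rotations \<Longrightarrow> s \<in> rotation_moves"
  by (simp_all add: rotation_moves_def)

lemma rotation_has_inverse:
  assumes "r \<in> rotations"
  shows "\<exists>s\<in>inverse_rotations. \<forall>x. s (r x) = x"
  using assms by (auto simp: rotations_def inverse_rotations_def)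

lemma inverse_rotation_has_inverse:
  assumes "s \<in> inverse_rotations"
  shows "\<exists>r\<in>rotations. \<forall>x. r (s x) = x"
  using assms by (auto simp: rotations_def inverse_rotations_def)

lemma rotation_move_has_inverse:
  assumes "r \<in> rotation_moves"
  shows "\<exists>s\<in>rotation_moves. \<forall>x. s (r x) = x"
  using assms rotation_has_inverse inverse_rotation_has_inverse
  unfolding rotation_moves_def by blast

fun markoff_form :: "triple \<Rightarrow> int" where
  "markoff_form (x1, x2, x3) = x1\<^sup>2 + x2\<^sup>2 + x3\<^sup>2 - 3 * x1 * x2 * x3"

lemma markoff_triple_iff_form: "markoff_triple x \<longleftrightarrow> markoff_form x = 0"
  by (cases x) simp

lemma markoff_form_rotation_move:
  "r \<in> rotation_moves \<Longrightarrow> markoff_form (r x) = markoff_form x"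
  by (cases x) (auto simp: rotation_moves_defs power2_eq_square algebra_simps)

fun sup_norm :: "triple \<Rightarrow> int" where
  "sup_norm (x1, x2, x3) = max \<bar>x1\<bar> (max \<bar>x2\<bar> \<bar>x3\<bar>)"

lemma markoff_size_le_sup_norm: "markoff_size x \<le> sup_norm x"
  by (cases x) auto

lemma sup_norm_le_iff: "sup_norm (a, b, c) \<le> M \<longleftrightarrow> \<bar>a\<bar> \<le> M \<and> \<bar>b\<bar> \<le> M \<and> \<bar>c\<bar> \<le> M"
  by simp

lemma sup_norm_nonneg: "0 \<le> sup_norm x"
  by (cases x) simp

lemma abs_vieta_coordinate_le:
  fixes a b c M :: int
  assumes "\<bar>a\<bar> \<le> M" "\<bar>b\<bar> \<le> M" "\<bar>c\<bar> \<le> M"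
  shows "\<bar>3 * a * b - c\<bar> \<le> 4 * M\<^sup>2"
proof -
  have "\<bar>a * b\<bar> \<le> M\<^sup>2"
    unfolding abs_mult power2_eq_square using assms by (intro mult_mono) auto
  then show ?thesis using assms(3) int_le_square[of M] unfolding mult.assoc by linarith
qed

lemma sup_norm_rotation_move:
  assumes "r \<in> rotation_moves"
  shows "sup_norm (r x) \<le> 4 * (sup_norm x)\<^sup>2"
proof -
  obtain a b c where x: "x = (a, b, c)" by (cases x)
  define M where "M = sup_norm x"
  have coords: "\<bar>a\<bar> \<le> M" "\<bar>b\<bar> \<le> M" "\<bar>c\<bar> \<le> M" by (simp_all add: M_def x)
  then have "\<bar>a\<bar> \<le> 4 * M\<^sup>2" "\<bar>b\<bar> \<le> 4 * M\<^sup>2" "\<bar>c\<bar> \<le> 4 * M\<^sup>2"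
    using int_le_square[of M] by linarith+
  moreover have "\<bar>3 * a * b - c\<bar> \<le> 4 * M\<^sup>2" "\<bar>3 * a * c - b\<bar> \<le> 4 * M\<^sup>2" "\<bar>3 * b * c - a\<bar> \<le> 4 * M\<^sup>2"
    by (intro abs_vieta_coordinate_le coords)+
  ultimately have "sup_norm (r (a, b, c)) \<le> 4 * M\<^sup>2"
    using assms unfolding rotation_moves_defs
    by (elim UnE insertE emptyE) (simp_all add: sup_norm_le_iff del: sup_norm.simps)
  then show ?thesis unfolding M_def x .
qed

inductive_set rotation_orbit :: "triple \<Rightarrow> triple set" for a where
  base: "a \<in> rotation_orbit a"
| move: "x \<in> rotation_orbit a \<Longrightarrow> r \<in> rotation_moves \<Longrightarrow> r x \<in> rotation_orbit a"

definition transpositions :: "(triple \<Rightarrow> triple) set" where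
  "transpositions = {perm12, perm13, perm23}"

lemma transposition_conjugates_rotation_move:
  assumes "\<pi> \<in> transpositions" "r \<in> rotation_moves"
  shows "\<exists>s\<in>rotation_moves. \<forall>x. \<pi> (r x) = s (\<pi> x)"
  using assms unfolding transpositions_def rotation_moves_defs
  by (elim UnE insertE emptyE; simp add: split_paired_All)

lemma transposition_rotation_orbit:
  assumes "\<pi> \<in> transpositions" "x \<in> rotation_orbit a"
  shows "\<pi> x \<in> rotation_orbit (\<pi> a)"
  using assms(2)
proof induction
  case base
  show ?case by (rule rotation_orbit.base)
next
  case (move x r)
  then show ?case
    using transposition_conjugates_rotation_move[OF assms(1)] by (metis rotation_orbit.move)
qed

lemma vieta_generator_cases:
  assumes "f \<in> vieta_generators"
  obtains "f \<in> transpositions"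
  | \<pi> r where "\<pi> \<in> transpositions" "r \<in> rotation_moves" "f = \<pi> \<circ> r"
proof -
  have "vieta1 = perm13 \<circ> rot2" "vieta2 = perm23 \<circ> rot1" "vieta3 = perm23 \<circ> rot1_inv"
    by (auto simp: fun_eq_iff)
  then show thesis
    using assms that unfolding vieta_generators_def transpositions_def rotation_moves_defs by blast
qed

lemma vieta_generator_involution: "f \<in> vieta_generators \<Longrightarrow> f (f x) = x"
  by (cases x) (auto simp: vieta_generators_def)

lemma vieta_generator_image_rotation_orbit:
  assumes "f \<in> vieta_generators"
  shows "f ` rotation_orbit (n, n, n) = rotation_orbit (n, n, n)"
proof -
  have transposition: "\<pi> x \<in> rotation_orbit (n, n, n)"
    if "\<pi> \<in> transpositions" "x \<in> rotation_orbit (n, n, n)" for \<pi> x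
    using transposition_rotation_orbit[OF that] that(1) by (auto simp: transpositions_def)
  have closed: "f x \<in> rotation_orbit (n, n, n)" if "x \<in> rotation_orbit (n, n, n)" for x
    using assms that
    by (cases rule: vieta_generator_cases) (auto intro: transposition rotation_orbit.move)
  moreover have "x \<in> f ` rotation_orbit (n, n, n)" if "x \<in> rotation_orbit (n, n, n)" for x
    using closed[OF that] vieta_generator_involution[OF assms, of x]
    by (intro rev_image_eqI[of "f x"]) simp_all
  ultimately show ?thesis by blast
qed

lemma vieta_group_diagonal_rotation_orbit:
  assumes "g \<in> vieta_group"
  shows "g (n, n, n) \<in> rotation_orbit (n, n, n)"
proof -
  have "g ` rotation_orbit (n, n, n) = rotation_orbit (n, n, n)"
    by (rule generate_BijGroup_image_eq[OF vieta_generators_carrier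
          vieta_generator_image_rotation_orbit assms[unfolded vieta_group_def]])
  then show ?thesis using rotation_orbit.base by blast
qed

section \<open>The Markoff graph modulo \<open>p\<close>\<close>

lemma reduce_reduce: "reduce p (reduce p x) = reduce p x"
  by (cases x) simp

lemma reduce_rotation_move:
  assumes "r \<in> rotation_moves"
  shows "reduce p (r (reduce p x)) = reduce p (r x)"
proof -
  have "(3 * (a mod int p) * (b mod int p) - c mod int p) mod int p = (3 * a * b - c) mod int p"
    for a b c
    unfolding cong_def[symmetric] by (intro cong_diff cong_mult cong_refl) simp_all
  then show ?thesis
    using assms by (cases x) (auto simp: rotation_moves_defs)
qed

lemma reduce_cancel_rotation_move:
  assumes "s \<in> rotation_moves" "\<forall>x. s (r x) = x"
  shows "reduce p (s (reduce p (r x))) = reduce p x"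
  by (simp add: assms reduce_rotation_move)

lemma markoff_form_reduce: "[markoff_form (reduce p x) = markoff_form x] (mod int p)"
  by (cases x) (simp, intro cong_diff cong_add cong_pow cong_mult cong_refl; simp)

lemma markoff_mod_iff:
  assumes "0 < p"
  shows "x \<in> markoff_mod p \<longleftrightarrow>
    reduce p x = x \<and> x \<noteq> (0, 0, 0) \<and> [markoff_form x = 0] (mod int p)"
proof -
  obtain a b c where x: "x = (a, b, c)" by (cases x)
  have "u mod int p = u \<longleftrightarrow> u \<in> {0..<int p}" for u
    using assms
    by (metis atLeastLessThan_iff mod_pos_pos_trivial of_nat_0_less_iff pos_mod_bound pos_mod_sign)
  then show ?thesis
    by (auto simp: x markoff_mod_def cong_iff_dvd_diff)
qed

lemma markoff_mod_modulus_pos: "x \<in> markoff_mod p \<Longrightarrow> 0 < p"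
  by (auto simp: markoff_mod_def)

lemma reduce_markoff_mod: "x \<in> markoff_mod p \<Longrightarrow> reduce p x = x"
  using markoff_mod_iff markoff_mod_modulus_pos by blast

lemma one_in_markoff_mod: "1 < p \<Longrightarrow> (1, 1, 1) \<in> markoff_mod p"
  by (simp add: markoff_mod_def)

lemma markoff_mod_rotation_move:
  assumes "x \<in> markoff_mod p" "r \<in> rotation_moves"
  shows "reduce p (r x) \<in> markoff_mod p"
proof -
  have p: "0 < p" using assms(1) by (rule markoff_mod_modulus_pos)
  have x: "reduce p x = x" "x \<noteq> (0, 0, 0)" "[markoff_form x = 0] (mod int p)"
    using assms(1) by (simp_all add: markoff_mod_iff[OF p])
  obtain s where s: "s \<in> rotation_moves" "\<forall>x. s (r x) = x"
    using rotation_move_has_inverse[OF assms(2)] by blast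
  have "reduce p (r x) \<noteq> (0, 0, 0)"
  proof
    assume "reduce p (r x) = (0, 0, 0)"
    moreover have "reduce p (s (0, 0, 0)) = (0, 0, 0)"
      using s(1) by (auto simp: rotation_moves_defs)
    ultimately show False
      using reduce_cancel_rotation_move[OF s, of p x] x by simp
  qed
  moreover have "[markoff_form (reduce p (r x)) = 0] (mod int p)"
  proof -
    have "[markoff_form (reduce p (r x)) = markoff_form (r x)] (mod int p)"
      by (rule markoff_form_reduce)
    also have "markoff_form (r x) = markoff_form x"
      using assms(2) by (rule markoff_form_rotation_move)
    also note x(3)
    finally show ?thesis .
  qed
  ultimately show ?thesis by (simp add: markoff_mod_iff[OF p] reduce_reduce)
qed

lemma finite_markoff_mod: "finite (markoff_mod p)"
  and card_markoff_mod_le: "card (markoff_mod p) \<le> p ^ 3"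
proof -
  let ?I = "{0..<int p}"
  have box: "markoff_mod p \<subseteq> ?I \<times> ?I \<times> ?I" by (auto simp: markoff_mod_def)
  then show "finite (markoff_mod p)" by (rule finite_subset) simp
  have "card (markoff_mod p) \<le> card (?I \<times> ?I \<times> ?I)" using box by (intro card_mono) auto
  then show "card (markoff_mod p) \<le> p ^ 3" by (simp add: card_cartesian_product power3_eq_cube)
qed

lemma card_markoff_mod_ge:
  assumes "2 < p"
  shows "2 \<le> card (markoff_mod p)"
proof -
  have "{(1, 1, 1), (1, 1, 2)} \<subseteq> markoff_mod p" using assms by (auto simp: markoff_mod_def)
  from card_mono[OF finite_markoff_mod this] show ?thesis by simp
qed

lemma markoff_edges_eq:
  "markoff_edges p = {(x, reduce p (r x)) | x r. x \<in> markoff_mod p \<and> r \<in> rotations}"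
  by (simp add: markoff_edges_def rotations_def)

lemma markoff_edges_subset: "markoff_edges p \<subseteq> markoff_mod p \<times> markoff_mod p"
  by (auto simp: markoff_edges_eq markoff_mod_rotation_move rotation_in_moves)

lemma markoff_edge_reverse:
  assumes "(x, y) \<in> markoff_edges p"
  obtains s where "s \<in> inverse_rotations" "x = reduce p (s y)"
proof -
  obtain r where r: "x \<in> markoff_mod p" "r \<in> rotations" "y = reduce p (r x)"
    using assms by (auto simp: markoff_edges_eq)
  obtain s where s: "s \<in> inverse_rotations" "\<forall>x. s (r x) = x"
    using rotation_has_inverse[OF r(2)] by blast
  then have "x = reduce p (s y)"
    using r by (simp add: reduce_cancel_rotation_move inverse_rotation_in_moves reduce_markoff_mod)
  with s(1) show thesis by (rule that)
qed

lemma markoff_neighbour_iff: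
  "(x, y) \<in> markoff_edges p \<union> (markoff_edges p)\<inverse> \<longleftrightarrow>
    x \<in> markoff_mod p \<and> (\<exists>r\<in>rotation_moves. y = reduce p (r x))"
proof
  assume "(x, y) \<in> markoff_edges p \<union> (markoff_edges p)\<inverse>"
  then consider (forward) "(x, y) \<in> markoff_edges p" | (backward) "(y, x) \<in> markoff_edges p"
    by blast
  then show "x \<in> markoff_mod p \<and> (\<exists>r\<in>rotation_moves. y = reduce p (r x))"
  proof cases
    case forward
    then show ?thesis by (auto simp: markoff_edges_eq intro: rotation_in_moves)
  next
    case backward
    then show ?thesis
      using markoff_edges_subset[of p]
      by (blast elim: markoff_edge_reverse intro: inverse_rotation_in_moves)
  qed
next
  assume "x \<in> markoff_mod p \<and> (\<exists>r\<in>rotation_moves. y = reduce p (r x))"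
  then obtain r where r: "x \<in> markoff_mod p" "r \<in> rotation_moves" "y = reduce p (r x)" by blast
  show "(x, y) \<in> markoff_edges p \<union> (markoff_edges p)\<inverse>"
  proof (cases "r \<in> rotations")
    case True
    then show ?thesis using r unfolding markoff_edges_eq by blast
  next
    case False
    then obtain t where t: "t \<in> rotations" "\<forall>x. t (r x) = x"
      using r(2) inverse_rotation_has_inverse unfolding rotation_moves_def by blast
    then have "reduce p (t y) = x"
      using r by (simp add: reduce_cancel_rotation_move rotation_in_moves reduce_markoff_mod)
    moreover have "y \<in> markoff_mod p"
      using r by (simp add: markoff_mod_rotation_move)
    ultimately show ?thesis using t(1) unfolding markoff_edges_eq by blast
  qed
qed

lemma card_incident_markoff_edges: "card (incident_edges (markoff_edges p) v) \<le> 6"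
proof -
  define outgoing where "outgoing = (\<lambda>r. (v, reduce p (r v))) ` rotations"
  define incoming where "incoming = (\<lambda>s. (reduce p (s v), v)) ` inverse_rotations"
  have "incident_edges (markoff_edges p) v \<subseteq> outgoing \<union> incoming"
  proof
    fix e assume e: "e \<in> incident_edges (markoff_edges p) v"
    then consider (out_edge) y where "e = (v, y)" | (in_edge) x where "e = (x, v)"
      by (cases e) (auto simp: incident_edges_def)
    then show "e \<in> outgoing \<union> incoming"
    proof cases
      case out_edge
      then show ?thesis using e by (auto simp: incident_edges_def markoff_edges_eq outgoing_def)
    next
      case in_edge
      then show ?thesis
        using e by (auto simp: incident_edges_def incoming_def elim!: markoff_edge_reverse)
    qed
  qed
  moreover have "finite (outgoing \<union> incoming)"
    by (simp add: outgoing_def incoming_def rotations_def inverse_rotations_def)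
  ultimately have "card (incident_edges (markoff_edges p) v) \<le> card (outgoing \<union> incoming)"
    by (rule card_mono[rotated])
  also have "\<dots> \<le> card outgoing + card incoming" by (rule card_Un_le)
  also have "\<dots> \<le> card rotations + card inverse_rotations"
    unfolding outgoing_def incoming_def
    by (intro add_mono card_image_le) (simp_all add: rotations_def inverse_rotations_def)
  also have "\<dots> \<le> 3 + 3"
    by (intro add_mono) (simp_all add: rotations_def inverse_rotations_def card_insert_if)
  finally show ?thesis by simp
qed

interpretation markoff_graph: bounded_degree_digraph "markoff_mod p" "markoff_edges p" 6
  by unfold_locales
    (simp_all add: finite_markoff_mod markoff_edges_subset card_incident_markoff_edges)

lemma rotation_orbit_reachable:
  assumes "a \<in> markoff_mod p" "z \<in> rotation_orbit a"
  shows "(a, reduce p z) \<in> (markoff_edges p \<union> (markoff_edges p)\<inverse>)\<^sup>*"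
  using assms(2)
proof induction
  case base
  then show ?case using assms(1) by (simp add: reduce_markoff_mod)
next
  case (move z r)
  have "reduce p z \<in> markoff_mod p"
    using move.IH assms(1) markoff_edges_subset[of p] by (auto elim: rtranclE)
  then have "(reduce p z, reduce p (r z)) \<in> markoff_edges p \<union> (markoff_edges p)\<inverse>"
    unfolding markoff_neighbour_iff using move.hyps(2) by (metis reduce_rotation_move)
  with move.IH show ?case by (rule rtrancl_into_rtrancl)
qed

lemma markoff_expansion_pos:
  assumes "strong_approximation p" "2 < p"
  shows "0 < markoff_expansion p"
  unfolding markoff_expansion_def
proof (rule markoff_graph.expansion_constant_pos)
  show "2 \<le> card (markoff_mod p)" using assms(2) by (rule card_markoff_mod_ge)
  show one: "(1, 1, 1) \<in> markoff_mod p" using assms(2) by (simp add: one_in_markoff_mod)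
  have "markoff_mod p = {reduce p (g (1, 1, 1)) | g. g \<in> vieta_group}"
    using assms(1) by (simp add: strong_approximation_def vieta_orbit_def)
  then show "markoff_mod p \<subseteq> (markoff_edges p \<union> (markoff_edges p)\<inverse>)\<^sup>* `` {(1, 1, 1)}"
    using rotation_orbit_reachable[OF one vieta_group_diagonal_rotation_orbit] by auto
qed

lemma markoff_expansion_le: "2 < p \<Longrightarrow> markoff_expansion p \<le> 6"
  using markoff_graph.expansion_constant_le_degree[OF card_markoff_mod_ge one_in_markoff_mod]
  by (simp add: markoff_expansion_def)

section \<open>Lifting walks to Markoff triples\<close>

lemma is_lift_iff: "is_lift p x y \<longleftrightarrow> markoff_triple y \<and> reduce p y = reduce p x"
  by (cases x; cases y) (simp add: cong_def)

lemma closed_neighbourhood_lift: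
  assumes "x \<in> closed_neighbourhood (markoff_edges p) {reduce p z}"
  shows "\<exists>w. reduce p w = x \<and> markoff_form w = markoff_form z \<and> sup_norm w \<le> 4 * (sup_norm z)\<^sup>2"
proof -
  have "x = reduce p z \<or> (reduce p z, x) \<in> markoff_edges p \<union> (markoff_edges p)\<inverse>"
    using assms by (auto simp: closed_neighbourhood_def)
  then consider (stay) "x = reduce p z"
    | (move) r where "r \<in> rotation_moves" "x = reduce p (r (reduce p z))"
    unfolding markoff_neighbour_iff by blast
  then show ?thesis
  proof cases
    case stay
    have "sup_norm z \<le> 4 * (sup_norm z)\<^sup>2"
      using int_le_square[of "sup_norm z"] zero_le_power2[of "sup_norm z"] by linarith
    with stay show ?thesis by blast
  next
    case move
    then have "reduce p (r z) = x" by (simp add: reduce_rotation_move)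
    then show ?thesis
      using markoff_form_rotation_move[OF move(1)] sup_norm_rotation_move[OF move(1)] by blast
  qed
qed

lemma graph_ball_lift:
  assumes "x \<in> graph_ball (markoff_edges p) (reduce p a) k"
  shows "\<exists>z. reduce p z = x \<and> markoff_form z = markoff_form a \<and>
    4 * sup_norm z \<le> (4 * sup_norm a) ^ 2 ^ k"
  using assms
proof (induction k arbitrary: x)
  case 0
  then show ?case by (intro exI[of _ a]) simp
next
  case (Suc k)
  then obtain y where y: "y \<in> graph_ball (markoff_edges p) (reduce p a) k"
    "x \<in> closed_neighbourhood (markoff_edges p) {y}"
    by (auto simp: graph_ball_Suc closed_neighbourhood_def)
  from Suc.IH[OF y(1)] obtain z where z: "reduce p z = y" "markoff_form z = markoff_form a"
    "4 * sup_norm z \<le> (4 * sup_norm a) ^ 2 ^ k" by blast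
  obtain w where w: "reduce p w = x" "markoff_form w = markoff_form z"
    "sup_norm w \<le> 4 * (sup_norm z)\<^sup>2"
    using closed_neighbourhood_lift[OF y(2)[folded z(1)]] by blast
  have "4 * sup_norm w \<le> (4 * sup_norm z)\<^sup>2"
    using w(3) by (simp add: power_mult_distrib)
  also have "\<dots> \<le> ((4 * sup_norm a) ^ 2 ^ k)\<^sup>2"
    using z(3) sup_norm_nonneg[of z] by (intro power_mono) auto
  also have "\<dots> = (4 * sup_norm a) ^ 2 ^ Suc k"
    unfolding power_Suc2 power_mult ..
  finally show ?case using w(1) w(2)[unfolded z(2)] by blast
qed

lemma small_lift_in_graph_ball:
  assumes "x \<in> markoff_mod p" "1 < p" "x \<in> graph_ball (markoff_edges p) (1, 1, 1) k"
  shows "\<exists>z. is_lift p x z \<and> markoff_size z < 4 ^ 2 ^ k"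
proof -
  have "reduce p (1, 1, 1) = (1, 1, 1)"
    using one_in_markoff_mod[OF assms(2)] by (rule reduce_markoff_mod)
  with assms(3) have "x \<in> graph_ball (markoff_edges p) (reduce p (1, 1, 1)) k" by (simp only:)
  from graph_ball_lift[OF this] obtain z where z: "reduce p z = x"
    "markoff_form z = markoff_form (1, 1, 1)" "4 * sup_norm z \<le> (4 * sup_norm (1, 1, 1)) ^ 2 ^ k"
    by blast
  have "is_lift p x z"
    using z(1,2) by (simp add: is_lift_iff markoff_triple_iff_form reduce_markoff_mod[OF assms(1)])
  moreover have "markoff_size z < 4 ^ 2 ^ k"
  proof -
    have "4 * sup_norm z \<le> 4 ^ 2 ^ k" using z(3) by simp
    moreover have "(0::int) < 4 ^ 2 ^ k" by simp
    ultimately show ?thesis using markoff_size_le_sup_norm[of z] by linarith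
  qed
  ultimately show ?thesis by blast
qed

lemma markoff_graph_radius:
  assumes "strong_approximation p" "3 < p" "x \<in> markoff_mod p"
  obtains k where "x \<in> graph_ball (markoff_edges p) (1, 1, 1) k"
    "2 ^ k \<le> ((real p ^ 3 + 3) / 2) powr (20 / ln (1 + markoff_expansion p / 3))"
proof -
  define A where "A = (real p ^ 3 + 3) / 2"
  define h where "h = markoff_expansion p"
  have h: "0 < h" "h \<le> 6"
    using markoff_expansion_pos markoff_expansion_le assms(1,2) by (auto simp: h_def)
  have "real p ^ 3 \<ge> 3 ^ 3" using assms(2) by (intro power_mono) auto
  then have "3 \<le> A" by (simp add: A_def)
  obtain n where n: "A \<le> (1 + h / 6) ^ n" "2 ^ (2 * n) \<le> A powr (6 / ln (1 + h / 3))"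
    by (rule power_ge_and_two_power_le_powr[of "1 + h / 6" "1 + h / 3" A])
      (use h \<open>3 \<le> A\<close> in \<open>auto simp: power2_eq_square algebra_simps\<close>)
  have "real (card (markoff_mod p)) \<le> real p ^ 3"
    using card_markoff_mod_le[of p] by (metis of_nat_le_iff of_nat_power)
  then have "real (card (markoff_mod p)) < real p ^ 3 + 3" by (rule le_less_trans) simp
  then have "card (markoff_mod p) / 2 < A"
    unfolding A_def by (rule divide_strict_right_mono) simp
  with n(1) have "card (markoff_mod p) / 2 < (1 + h / 6) ^ n" by linarith
  then have "x \<in> graph_ball (markoff_edges p) (1, 1, 1) (2 * n)"
    using markoff_graph.expander_diameter[OF one_in_markoff_mod assms(3), of n] h(1) assms(2)
    by (simp add: h_def markoff_expansion_def)
  moreover have "A powr (6 / ln (1 + h / 3)) \<le> A powr (20 / ln (1 + h / 3))"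
    using h(1) \<open>3 \<le> A\<close> by (intro powr_mono divide_right_mono) auto
  ultimately show thesis using n(2) that[of "2 * n"] by (auto simp: h_def A_def)
qed

lemma markoff_size_nonneg:
  assumes "markoff_triple x"
  shows "0 \<le> markoff_size x"
proof (rule ccontr)
  obtain a b c where x: "x = (a, b, c)" by (cases x)
  assume "\<not> 0 \<le> markoff_size x"
  then have "a < 0" "b < 0" "c < 0" by (auto simp: x)
  then have "a * b * c < 0" by (simp add: mult_neg_neg mult_pos_neg)
  moreover have "0 \<le> a\<^sup>2 + b\<^sup>2 + c\<^sup>2" by simp
  moreover have "a\<^sup>2 + b\<^sup>2 + c\<^sup>2 = 3 * (a * b * c)" using assms by (simp add: x)
  ultimately show False by linarith
qed

theorem theorem1p3:
  fixes p :: nat and x :: triple and \<epsilon> \<alpha> :: real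
  assumes "prime p" and "p > 3"
    and "strong_approximation p"
    and "x \<in> markoff_mod p"
    and "\<epsilon> = (3 + sqrt 5) / 2"
    and "\<alpha> = ((real p ^ 3 + 3) / 2) powr (20 / ln (1 + markoff_expansion p / 3))"
  shows "(\<exists>y. is_arg_min markoff_size (is_lift p x) y) \<and>
         (\<forall>y. is_arg_min markoff_size (is_lift p x) y \<longrightarrow>
              real_of_int (markoff_size y) < (3 * \<epsilon>) powr \<alpha>)"
proof (intro conjI allI impI)
  obtain k where k: "x \<in> graph_ball (markoff_edges p) (1, 1, 1) k" "2 ^ k \<le> \<alpha>"
    using markoff_graph_radius[OF assms(3,2,4)] unfolding assms(6) by blast
  obtain z where lift: "is_lift p x z" and size_z: "markoff_size z < 4 ^ 2 ^ k"
    using small_lift_in_graph_ball[OF assms(4) _ k(1)] assms(2) by auto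
  show "\<exists>y. is_arg_min markoff_size (is_lift p x) y"
    using lift markoff_size_nonneg by (intro ex_is_arg_min_int) (auto simp: is_lift_iff)
  fix y assume "is_arg_min markoff_size (is_lift p x) y"
  then have "markoff_size y \<le> markoff_size z"
    using lift unfolding is_arg_min_linorder by blast
  with size_z have "markoff_size y < 4 ^ 2 ^ k" by linarith
  then have "real_of_int (markoff_size y) < 4 ^ 2 ^ k"
    by (metis of_int_less_iff of_int_numeral of_int_power)
  also have "\<dots> = 4 powr (2 ^ k)" by (simp flip: powr_realpow)
  also have "\<dots> \<le> 4 powr \<alpha>" using k(2) by (intro powr_mono) auto
  also have "\<dots> \<le> (3 * \<epsilon>) powr \<alpha>"
    using real_sqrt_ge_zero[of 5] by (intro powr_mono2) (auto simp: assms(5,6))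
  finally show "real_of_int (markoff_size y) < (3 * \<epsilon>) powr \<alpha>" .
qed

end
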